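(* Let $a,b,c,d\in\mathbb{R}$ with $a<b$ and $c<d$, let $\Delta:=[a,b]\times[c,d]$, and let $f,g:\Delta\to\mathbb{R}$ satisfy the following: (1) $\Delta$ contains no point of the form $(0,y)$ or $(x,0)$ (in particular not $(0,0)$). (2) For each fixed $y_0\in[c,d]$, the functions given by $x\mapsto f(x,y_0)$ and $x\mapsto g(x,y_0)$ are continuous on $[a,b]$ and differentiable on $(a,b)$. (3) For each fixed $x_0\in[a,b]$, the functions given by $y\mapsto f_x(x_0,y)$ and $y\mapsto g_x(x_0,y)$ are continuous on $[c,d]$ and differentiable on $(c,d)$. Then for all pairs $x_1,x_2\in(a,b)$ with $x_1\neq x_2$ and $y_1,y_2\in(c,d)$ with $y_1\neq y_2$, there exists $(\xi_1,\xi_2)$, with $\xi_1$ in the open interval with endpoints $x_1,x_2$ and $\xi_2$ in the open interval with endpoints $y_1,y_2$, such that $$\frac{\xi_1\xi_2\frac{\partial^2 g}{\partial t\partial s}(\xi_1,\xi_2)-\xi_1\frac{\partial g}{\partial t}(\xi_1,\xi_2)-\xi_2\frac{\partial g}{\partial s}(\xi_1,\xi_2)+g(\xi_1,\xi_2)}{g(x_2,y_2)-g(x_2,y_1)-g(x_1,y_2)+g(x_1,y_1)}$$ $$-\frac{\xi_1\xi_2\frac{\partial^2 f}{\partial t\partial s}(\xi_1,\xi_2)-\xi_1\frac{\partial f}{\partial t}(\xi_1,\xi_2)-\xi_2\frac{\partial f}{\partial s}(\xi_1,\xi_2)+f(\xi_1,\xi_2)}{f(x_2,y_2)-f(x_2,y_1)-f(x_1,y_2)+f(x_1,y_1)}$$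 $$=\frac{x_2y_2g(x_1,y_1)-x_1y_2g(x_2,y_1)-x_2y_1g(x_1,y_2)+x_1y_1g(x_2,y_2)}{(x_2-x_1)(y_2-y_1)\left[g(x_2,y_2)-g(x_2,y_1)-g(x_1,y_2)+g(x_1,y_1)\right]}$$ $$-\frac{x_2y_2f(x_1,y_1)-x_2y_1f(x_1,y_2)-x_1y_2f(x_2,y_1)+x_1y_1f(x_2,y_2)}{(x_2-x_1)(y_2-y_1)\left[f(x_2,y_2)-f(x_2,y_1)-f(x_1,y_2)+f(x_1,y_1)\right]}.$$
   Context: $f_x=\frac{\partial f}{\partial t}$ denotes the partial derivative of $f$ with respect to the first variable, $\frac{\partial f}{\partial s}$ the partial derivative with respect to the second variable, and $\frac{\partial^2 f}{\partial t\partial s}$ the mixed second-order partial derivative of $f$ with respect to the two variables; likewise for $g$.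
   Formalization: The formal statement also assumes that ∂f/∂s and ∂g/∂s exist on (a,b)×(c,d); (1)–(3) do not imply this (e.g. f(x,y)=xy+h(y) with h nowhere differentiable), and the conclusion uses these derivatives. *)

theory Defs
  imports "HOL-Analysis.Analysis"
begin

text \<open>
  A function on a rectangle \<open>X \<times> Y\<close> is represented by a total curried function; only its values
  on the rectangle matter. Partial derivatives are therefore taken \<^emph>\<open>within\<close> the corresponding
  side of the rectangle: at interior points this is the ordinary partial derivative, at the end
  points of a compact interval the one-sided one. Where the derivative does not exist, the value
  is unspecified.
\<close>

definition partial_t :: "real set \<Rightarrow> (real \<Rightarrow> real \<Rightarrow> real) \<Rightarrow> real \<Rightarrow> real \<Rightarrow> real" where
  "partial_t X f x y = vector_derivative (\<lambda>t. f t y) (at x within X)"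

definition partial_s :: "real set \<Rightarrow> (real \<Rightarrow> real \<Rightarrow> real) \<Rightarrow> real \<Rightarrow> real \<Rightarrow> real" where
  "partial_s Y f x y = vector_derivative (\<lambda>s. f x s) (at y within Y)"

text \<open>
  Existence of \<open>\<partial>f/\<partial>s\<close> does not follow from regularity in \<open>t\<close> and of \<open>\<partial>f/\<partial>t\<close> in \<open>s\<close> (add a
  nowhere differentiable function of \<open>s\<close> to \<open>f\<close>), so it has to be assumed wherever
  \<^term>\<open>partial_s\<close> is meant to be a genuine derivative.
\<close>

text \<open>
  The order of differentiation is first \<open>t\<close>, then \<open>s\<close>: differentiability of \<open>\<partial>f/\<partial>t\<close> in \<open>s\<close> is
  what is assumed of the functions considered here, and nothing guarantees that the opposite
  order exists.
\<close>

definition partial_ts ::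
    "real set \<Rightarrow> real set \<Rightarrow> (real \<Rightarrow> real \<Rightarrow> real) \<Rightarrow> real \<Rightarrow> real \<Rightarrow> real" where
  "partial_ts X Y f = partial_s Y (partial_t X f)"

end

theory Submission
  imports Defs
begin

text \<open>
  Both sides of the claim are linear in the pair \<open>(g, f)\<close> once the two rectangular differences
  in the denominators are read as constants. The claim is therefore a statement about the single
  function \<open>h = g / \<Delta>g - f / \<Delta>f\<close>, and division by zero is harmless, since it replaces the same
  coefficient by \<open>0\<close> on both sides. For \<open>h\<close> it is a two-variable form of Pompeiu's mean value
  theorem, which says that the tangent of \<open>\<phi>\<close> at some intermediate point \<open>\<xi>\<close> meets the ordinate
  axis where the chord over \<open>x\<^sub>1\<close> and \<open>x\<^sub>2\<close> does:
  \<open>\<phi> \<xi> - \<xi> * \<phi>' \<xi> = (x\<^sub>2 * \<phi> x\<^sub>1 - x\<^sub>1 * \<phi> x\<^sub>2) / (x\<^sub>2 - x\<^sub>1)\<close>.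

  Write \<open>P\<^sub>t h = h - t h\<^sub>t\<close> and \<open>P\<^sub>s h = h - s h\<^sub>s\<close> for the corresponding operators in the two
  variables. The numerator at \<open>(\<xi>\<^sub>1, \<xi>\<^sub>2)\<close> is \<open>P\<^sub>s (P\<^sub>t h)\<close>, and the right-hand side is the chord
  intercept in \<open>s\<close> of the chord intercept in \<open>t\<close>. So Pompeiu's theorem is used once in each
  direction (\<open>pompeiu_mean_value\<close>, \<open>pompeiu_mean_value_rectangle\<close>), with the same order
  \<open>t\<close>, then \<open>s\<close>, in which the mixed derivative is formed.
\<close>

text \<open>
  The number \<open>K\<close> below is the intercept of the chord. Then \<open>(\<phi> t - K) / t\<close> is the slope of the
  line from \<open>(0, K)\<close> to the graph, which is the same at both ends, so Rolle's theorem applies to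
  it; avoiding \<open>t = 0\<close> is what makes this quotient differentiable.
\<close>

lemma pompeiu_mean_value:
  fixes \<phi> \<phi>' :: "real \<Rightarrow> real"
  assumes "x1 \<noteq> x2"
    and nz: "\<And>t. t \<in> {min x1 x2..max x1 x2} \<Longrightarrow> t \<noteq> 0"
    and deriv: "\<And>t. t \<in> {min x1 x2..max x1 x2} \<Longrightarrow> (\<phi> has_real_derivative \<phi>' t) (at t)"
  obtains \<xi> where "\<xi> \<in> {min x1 x2<..<max x1 x2}"
    and "\<phi> \<xi> - \<xi> * \<phi>' \<xi> = (x2 * \<phi> x1 - x1 * \<phi> x2) / (x2 - x1)"
proof -
  define K where "K = (x2 * \<phi> x1 - x1 * \<phi> x2) / (x2 - x1)"
  define q where "q t = (\<phi> t - K) / t" for t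
  define q' where "q' t = (\<phi>' t * t - (\<phi> t - K)) / (t * t)" for t
  have q_deriv: "(q has_real_derivative q' t) (at t)" if "t \<in> {min x1 x2..max x1 x2}" for t
    unfolding q_def q'_def
    using deriv[OF that] nz[OF that] by (auto intro!: derivative_eq_intros)
  have "x1 \<noteq> 0" "x2 \<noteq> 0"
    using nz[of x1] nz[of x2] by auto
  have "q x1 = q x2"
  proof -
    have "x2 * (\<phi> x1 - K) = x1 * (\<phi> x2 - K)"
      using \<open>x1 \<noteq> x2\<close> unfolding K_def by (simp add: divide_simps) (simp add: algebra_simps)
    then show ?thesis
      using \<open>x1 \<noteq> 0\<close> \<open>x2 \<noteq> 0\<close> unfolding q_def by (simp add: field_simps)
  qed
  then have "q (min x1 x2) = q (max x1 x2)"
    by (simp add: min_def max_def)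
  moreover have "continuous_on {min x1 x2..max x1 x2} q"
    by (rule DERIV_continuous_on) (rule has_field_derivative_at_within[OF q_deriv])
  moreover have "(q has_derivative (\<lambda>h. q' t * h)) (at t)" if "min x1 x2 < t" "t < max x1 x2" for t
    using q_deriv[of t] that unfolding has_field_derivative_def by simp
  ultimately obtain \<xi> where \<xi>: "min x1 x2 < \<xi>" "\<xi> < max x1 x2" and "(\<lambda>h. q' \<xi> * h) = (\<lambda>h. 0)"
    using Rolle_deriv[of "min x1 x2" "max x1 x2" q "\<lambda>t h. q' t * h"] \<open>x1 \<noteq> x2\<close>
    by (auto simp: min_def max_def split: if_splits)
  then have "q' \<xi> = 0"
    by (metis mult_cancel_left1 mult.right_neutral)
  moreover have "\<xi> \<noteq> 0"
    using nz[of \<xi>] \<xi> by simp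
  ultimately have "\<phi> \<xi> - \<xi> * \<phi>' \<xi> = K"
    unfolding q'_def by (simp add: algebra_simps)
  with \<xi> show ?thesis
    using that unfolding K_def by simp
qed

text \<open>
  The chord intercept in \<open>s\<close> is taken of the whole functions \<open>h(\<cdot>, y1)\<close> and \<open>h(\<cdot>, y2)\<close> before the
  theorem is used in \<open>t\<close>. In this way one and the same \<open>\<xi>1\<close> serves both values of \<open>s\<close>, and the
  second step can be carried out along the line \<open>t = \<xi>1\<close>.
\<close>

lemma pompeiu_mean_value_rectangle:
  fixes h ht hs hts :: "real \<Rightarrow> real \<Rightarrow> real"
  assumes "x1 \<noteq> x2" "y1 \<noteq> y2"
    and x: "x1 \<in> {a<..<b}" "x2 \<in> {a<..<b}" and y: "y1 \<in> {c<..<d}" "y2 \<in> {c<..<d}"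
    and nz: "0 \<notin> {a<..<b}" "0 \<notin> {c<..<d}"
    and t: "\<And>x y. \<lbrakk>x \<in> {a<..<b}; y \<in> {c<..<d}\<rbrakk> \<Longrightarrow> ((\<lambda>t. h t y) has_real_derivative ht x y) (at x)"
    and s: "\<And>x y. \<lbrakk>x \<in> {a<..<b}; y \<in> {c<..<d}\<rbrakk> \<Longrightarrow> (h x has_real_derivative hs x y) (at y)"
    and ts: "\<And>x y. \<lbrakk>x \<in> {a<..<b}; y \<in> {c<..<d}\<rbrakk> \<Longrightarrow> (ht x has_real_derivative hts x y) (at y)"
  obtains \<xi>1 \<xi>2 where "\<xi>1 \<in> {min x1 x2<..<max x1 x2}" "\<xi>2 \<in> {min y1 y2<..<max y1 y2}"
    and "\<xi>1 * \<xi>2 * hts \<xi>1 \<xi>2 - \<xi>1 * ht \<xi>1 \<xi>2 - \<xi>2 * hs \<xi>1 \<xi>2 + h \<xi>1 \<xi>2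
      = (x2 * y2 * h x1 y1 - x1 * y2 * h x2 y1 - x2 * y1 * h x1 y2 + x1 * y1 * h x2 y2)
        / ((x2 - x1) * (y2 - y1))"
proof -
  have x_in: "t \<in> {a<..<b}" if "t \<in> {min x1 x2..max x1 x2}" for t
    using that x by (auto simp: min_def max_def split: if_splits)
  have y_in: "t \<in> {c<..<d}" if "t \<in> {min y1 y2..max y1 y2}" for t
    using that y by (auto simp: min_def max_def split: if_splits)
  obtain \<xi>1 where \<xi>1: "\<xi>1 \<in> {min x1 x2<..<max x1 x2}"
    and eq1: "(y2 * h \<xi>1 y1 - y1 * h \<xi>1 y2) - \<xi>1 * (y2 * ht \<xi>1 y1 - y1 * ht \<xi>1 y2)
      = (x2 * (y2 * h x1 y1 - y1 * h x1 y2) - x1 * (y2 * h x2 y1 - y1 * h x2 y2)) / (x2 - x1)"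
  proof (rule pompeiu_mean_value[of x1 x2 "\<lambda>t. y2 * h t y1 - y1 * h t y2"
        "\<lambda>t. y2 * ht t y1 - y1 * ht t y2"])
    show "((\<lambda>t. y2 * h t y1 - y1 * h t y2) has_real_derivative y2 * ht t y1 - y1 * ht t y2) (at t)"
      if "t \<in> {min x1 x2..max x1 x2}" for t
      by (intro derivative_intros DERIV_cmult t x_in[OF that] y)
  qed (use \<open>x1 \<noteq> x2\<close> nz x_in in blast)+
  then have \<xi>1_in: "\<xi>1 \<in> {a<..<b}"
    using x_in by simp
  obtain \<xi>2 where \<xi>2: "\<xi>2 \<in> {min y1 y2<..<max y1 y2}"
    and eq2: "(h \<xi>1 \<xi>2 - \<xi>1 * ht \<xi>1 \<xi>2) - \<xi>2 * (hs \<xi>1 \<xi>2 - \<xi>1 * hts \<xi>1 \<xi>2)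
      = (y2 * (h \<xi>1 y1 - \<xi>1 * ht \<xi>1 y1) - y1 * (h \<xi>1 y2 - \<xi>1 * ht \<xi>1 y2)) / (y2 - y1)"
  proof (rule pompeiu_mean_value[of y1 y2 "\<lambda>s. h \<xi>1 s - \<xi>1 * ht \<xi>1 s"
        "\<lambda>s. hs \<xi>1 s - \<xi>1 * hts \<xi>1 s"])
    show "((\<lambda>s. h \<xi>1 s - \<xi>1 * ht \<xi>1 s) has_real_derivative hs \<xi>1 t - \<xi>1 * hts \<xi>1 t) (at t)"
      if "t \<in> {min y1 y2..max y1 y2}" for t
      by (intro derivative_intros DERIV_cmult s ts \<xi>1_in y_in[OF that])
  qed (use \<open>y1 \<noteq> y2\<close> nz y_in in blast)+
  have "\<xi>1 * \<xi>2 * hts \<xi>1 \<xi>2 - \<xi>1 * ht \<xi>1 \<xi>2 - \<xi>2 * hs \<xi>1 \<xi>2 + h \<xi>1 \<xi>2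
      = ((y2 * h \<xi>1 y1 - y1 * h \<xi>1 y2) - \<xi>1 * (y2 * ht \<xi>1 y1 - y1 * ht \<xi>1 y2)) / (y2 - y1)"
    using eq2 by (simp add: algebra_simps)
  also have "\<dots> = (x2 * (y2 * h x1 y1 - y1 * h x1 y2) - x1 * (y2 * h x2 y1 - y1 * h x2 y2))
      / ((x2 - x1) * (y2 - y1))"
    unfolding eq1 by simp
  also have "\<dots> = (x2 * y2 * h x1 y1 - x1 * y2 * h x2 y1 - x2 * y1 * h x1 y2 + x1 * y1 * h x2 y2)
      / ((x2 - x1) * (y2 - y1))"
    by (simp add: algebra_simps)
  finally show ?thesis
    using that[OF \<xi>1 \<xi>2] by blast
qed

lemma has_real_derivative_within_Icc:
  fixes u :: "real \<Rightarrow> real"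
  assumes "u differentiable_on {a<..<b}" "x \<in> {a<..<b}"
  shows "(u has_real_derivative vector_derivative u (at x within {a..b})) (at x)"
proof -
  have "u differentiable at x"
    using assms by (simp add: differentiable_on_eq_differentiable_at)
  moreover have "at x within {a..b} = at x"
    using assms(2) by (simp add: at_within_Icc_at)
  ultimately show ?thesis
    by (simp add: has_real_derivative_iff_has_vector_derivative vector_derivative_works)
qed

theorem theorem7:
  fixes a b c d :: real
    and f g :: "real \<Rightarrow> real \<Rightarrow> real"
  assumes ab: "a < b" and cd: "c < d"
    and no_axes: "\<forall>y. (0, y) \<notin> {a..b} \<times> {c..d}"
                 "\<forall>x. (x, 0) \<notin> {a..b} \<times> {c..d}"
    and f_x: "\<forall>y0\<in>{c..d}. continuous_on {a..b} (\<lambda>x. f x y0)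
                        \<and> (\<lambda>x. f x y0) differentiable_on {a<..<b}"
    and f_xy: "\<forall>x0\<in>{a..b}. continuous_on {c..d} (\<lambda>y. partial_t {a..b} f x0 y)
                        \<and> (\<lambda>y. partial_t {a..b} f x0 y) differentiable_on {c<..<d}"
    and f_y: "\<forall>x0\<in>{a<..<b}. (\<lambda>y. f x0 y) differentiable_on {c<..<d}"
    and g_x: "\<forall>y0\<in>{c..d}. continuous_on {a..b} (\<lambda>x. g x y0)
                        \<and> (\<lambda>x. g x y0) differentiable_on {a<..<b}"
    and g_xy: "\<forall>x0\<in>{a..b}. continuous_on {c..d} (\<lambda>y. partial_t {a..b} g x0 y)
                        \<and> (\<lambda>y. partial_t {a..b} g x0 y) differentiable_on {c<..<d}"
    and g_y: "\<forall>x0\<in>{a<..<b}. (\<lambda>y. g x0 y) differentiable_on {c<..<d}"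
  shows "\<forall>x1\<in>{a<..<b}. \<forall>x2\<in>{a<..<b}. \<forall>y1\<in>{c<..<d}. \<forall>y2\<in>{c<..<d}.
    x1 \<noteq> x2 \<longrightarrow> y1 \<noteq> y2 \<longrightarrow>
    (\<exists>\<xi>1\<in>{min x1 x2<..<max x1 x2}. \<exists>\<xi>2\<in>{min y1 y2<..<max y1 y2}.
        (\<xi>1 * \<xi>2 * partial_ts {a..b} {c..d} g \<xi>1 \<xi>2
            - \<xi>1 * partial_t {a..b} g \<xi>1 \<xi>2
            - \<xi>2 * partial_s {c..d} g \<xi>1 \<xi>2
            + g \<xi>1 \<xi>2)
          / (g x2 y2 - g x2 y1 - g x1 y2 + g x1 y1)
        - (\<xi>1 * \<xi>2 * partial_ts {a..b} {c..d} f \<xi>1 \<xi>2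
            - \<xi>1 * partial_t {a..b} f \<xi>1 \<xi>2
            - \<xi>2 * partial_s {c..d} f \<xi>1 \<xi>2
            + f \<xi>1 \<xi>2)
          / (f x2 y2 - f x2 y1 - f x1 y2 + f x1 y1)
        = (x2 * y2 * g x1 y1 - x1 * y2 * g x2 y1 - x2 * y1 * g x1 y2 + x1 * y1 * g x2 y2)
          / ((x2 - x1) * (y2 - y1) * (g x2 y2 - g x2 y1 - g x1 y2 + g x1 y1))
        - (x2 * y2 * f x1 y1 - x2 * y1 * f x1 y2 - x1 * y2 * f x2 y1 + x1 * y1 * f x2 y2)
          / ((x2 - x1) * (y2 - y1) * (f x2 y2 - f x2 y1 - f x1 y2 + f x1 y1)))"
proof (intro ballI impI)
  fix x1 x2 y1 y2
  assume x: "x1 \<in> {a<..<b}" "x2 \<in> {a<..<b}" and y: "y1 \<in> {c<..<d}" "y2 \<in> {c<..<d}"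
    and neq: "x1 \<noteq> x2" "y1 \<noteq> y2"
  have partials: "((\<lambda>t. k t y) has_real_derivative partial_t {a..b} k x y) (at x)"
      "(k x has_real_derivative partial_s {c..d} k x y) (at y)"
      "(partial_t {a..b} k x has_real_derivative partial_ts {a..b} {c..d} k x y) (at y)"
    if "\<forall>y0\<in>{c..d}. continuous_on {a..b} (\<lambda>x. k x y0)
          \<and> (\<lambda>x. k x y0) differentiable_on {a<..<b}"
      "\<forall>x0\<in>{a..b}. continuous_on {c..d} (\<lambda>y. partial_t {a..b} k x0 y)
          \<and> (\<lambda>y. partial_t {a..b} k x0 y) differentiable_on {c<..<d}"
      "\<forall>x0\<in>{a<..<b}. (\<lambda>y. k x0 y) differentiable_on {c<..<d}"
      "x \<in> {a<..<b}" "y \<in> {c<..<d}" for k x y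
    using that unfolding partial_ts_def partial_t_def[of _ _ x y] partial_s_def
    by (auto intro!: has_real_derivative_within_Icc)
  note f_partials = partials[OF f_x f_xy f_y] and g_partials = partials[OF g_x g_xy g_y]
  define \<alpha> where "\<alpha> = inverse (g x2 y2 - g x2 y1 - g x1 y2 + g x1 y1)"
  define \<beta> where "\<beta> = inverse (f x2 y2 - f x2 y1 - f x1 y2 + f x1 y1)"
  define comb where "comb u v x y = \<alpha> * u x y - \<beta> * v x y" for u v :: "real \<Rightarrow> real \<Rightarrow> real" and x y
  have nz: "0 \<notin> {a<..<b}" "0 \<notin> {c<..<d}"
    using no_axes(1)[rule_format, of c] no_axes(2)[rule_format, of a] ab cd by auto
  obtain \<xi>1 \<xi>2 where \<xi>: "\<xi>1 \<in> {min x1 x2<..<max x1 x2}" "\<xi>2 \<in> {min y1 y2<..<max y1 y2}"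
    and eq: "\<xi>1 * \<xi>2 * comb (partial_ts {a..b} {c..d} g) (partial_ts {a..b} {c..d} f) \<xi>1 \<xi>2
        - \<xi>1 * comb (partial_t {a..b} g) (partial_t {a..b} f) \<xi>1 \<xi>2
        - \<xi>2 * comb (partial_s {c..d} g) (partial_s {c..d} f) \<xi>1 \<xi>2
        + comb g f \<xi>1 \<xi>2
      = (x2 * y2 * comb g f x1 y1 - x1 * y2 * comb g f x2 y1
          - x2 * y1 * comb g f x1 y2 + x1 * y1 * comb g f x2 y2) / ((x2 - x1) * (y2 - y1))"
    by (rule pompeiu_mean_value_rectangle[OF neq x y nz, of "comb g f"
          "comb (partial_t {a..b} g) (partial_t {a..b} f)"
          "comb (partial_s {c..d} g) (partial_s {c..d} f)"
          "comb (partial_ts {a..b} {c..d} g) (partial_ts {a..b} {c..d} f)"])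
      (unfold comb_def, (intro derivative_intros DERIV_cmult f_partials g_partials; assumption)+)
  show "\<exists>\<xi>1\<in>{min x1 x2<..<max x1 x2}. \<exists>\<xi>2\<in>{min y1 y2<..<max y1 y2}.
        (\<xi>1 * \<xi>2 * partial_ts {a..b} {c..d} g \<xi>1 \<xi>2
            - \<xi>1 * partial_t {a..b} g \<xi>1 \<xi>2
            - \<xi>2 * partial_s {c..d} g \<xi>1 \<xi>2
            + g \<xi>1 \<xi>2)
          / (g x2 y2 - g x2 y1 - g x1 y2 + g x1 y1)
        - (\<xi>1 * \<xi>2 * partial_ts {a..b} {c..d} f \<xi>1 \<xi>2
            - \<xi>1 * partial_t {a..b} f \<xi>1 \<xi>2
            - \<xi>2 * partial_s {c..d} f \<xi>1 \<xi>2
            + f \<xi>1 \<xi>2)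
          / (f x2 y2 - f x2 y1 - f x1 y2 + f x1 y1)
        = (x2 * y2 * g x1 y1 - x1 * y2 * g x2 y1 - x2 * y1 * g x1 y2 + x1 * y1 * g x2 y2)
          / ((x2 - x1) * (y2 - y1) * (g x2 y2 - g x2 y1 - g x1 y2 + g x1 y1))
        - (x2 * y2 * f x1 y1 - x2 * y1 * f x1 y2 - x1 * y2 * f x2 y1 + x1 * y1 * f x2 y2)
          / ((x2 - x1) * (y2 - y1) * (f x2 y2 - f x2 y1 - f x1 y2 + f x1 y1))"
    using eq
    by (intro bexI[OF _ \<xi>(1)] bexI[OF _ \<xi>(2)])
      (simp add: comb_def divide_inverse inverse_mult_distrib
        flip: \<alpha>_def \<beta>_def, simp add: algebra_simps)
qed

end
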